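(* Let $A$ be a finite-dimensional elementary $n$-Lie algebra over a field $\mathbf{F}$. Then the following statements hold: (1) Any subalgebra of $A$ is elementary. (2) Any quotient algebra of $A$ (by an ideal) is elementary. Moreover, (3) the direct sum of finitely many finite-dimensional elementary $n$-Lie algebras over $\mathbf{F}$ is elementary.
   Context: An $n$-Lie algebra ($n\ge 2$) over a field $\mathbf{F}$ is a vector space $A$ over $\mathbf{F}$ with an $n$-ary multilinear operation $[\,,\dots,\,]$ satisfying $[x_1,\dots,x_n]=\operatorname{sgn}(\sigma)[x_{\sigma(1)},\dots,x_{\sigma(n)}]$ for all $\sigma\in S_n$ and $[[x_1,\dots,x_n],y_2,\dots,y_n]=\sum_{i=1}^n[x_1,\dots,[x_i,y_2,\dots,y_n],\dots,x_n]$. A subalgebra is a subspace $B$ with $[B,\dots,B]\subseteq B$; an ideal is a subspace $I$ with $[I,A,\dots,A]\subseteq I$. A proper subalgebra $M$ is maximal if the only subalgebra properly containing $M$ is $A$ itself. The Frattini subalgebra $F(A)$ is the intersection of all maximal subalgebras of $A$ (with $F(0)=0$), and $\Phi(A)$ is the largest ideal of $A$ contained in $F(A)$. $A$ is elementary if $\Phi(C)=0$ for every subalgebra $C$ of $A$ (including $A$ itself). The direct sum of $n$-Lie algebras carries the componentwise bracket, so each summand is an ideal. *)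

theory Defs
  imports "Jordan_Normal_Form.Missing_VectorSpace" "HOL-Combinatorics.Permutations"
    "HOL-Algebra.QuotRing"
begin

text \<open>
  The bracket takes the list of its arguments; only its values on lists of length \<open>n\<close> over the
  carrier matter.  The fields \<open>mult\<close> and \<open>one\<close> inherited from \<open>module\<close> play no role.
\<close>

record ('k, 'v) nlie = "('k, 'v) module" +
  bracket :: "'v list \<Rightarrow> 'v"

text \<open>
  Skew-symmetry is required in the sign form only: in characteristic 2 the bracket is symmetric
  and need not vanish on lists with repeated entries.
\<close>

locale nlie_algebra = vectorspace K A
  for K :: "('k, 'm) ring_scheme" and A :: "('k, 'v, 'z) nlie_scheme" +
  fixes n :: nat
  assumes n_ge_2: "2 \<le> n"
    and bracket_closed:
      "\<lbrakk>length xs = n; set xs \<subseteq> carrier A\<rbrakk> \<Longrightarrow> bracket A xs \<in> carrier A"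
    and bracket_add:
      "\<lbrakk>length xs = n; set xs \<subseteq> carrier A; i < n; x \<in> carrier A; y \<in> carrier A\<rbrakk> \<Longrightarrow>
        bracket A (xs[i := x \<oplus>\<^bsub>A\<^esub> y]) = bracket A (xs[i := x]) \<oplus>\<^bsub>A\<^esub> bracket A (xs[i := y])"
    and bracket_smult:
      "\<lbrakk>length xs = n; set xs \<subseteq> carrier A; i < n; c \<in> carrier K; x \<in> carrier A\<rbrakk> \<Longrightarrow>
        bracket A (xs[i := c \<odot>\<^bsub>A\<^esub> x]) = c \<odot>\<^bsub>A\<^esub> bracket A (xs[i := x])"
    and bracket_permute:
      "\<lbrakk>length xs = n; set xs \<subseteq> carrier A; \<sigma> permutes {..<n}\<rbrakk> \<Longrightarrow>
        bracket A xs = [sign \<sigma>] \<cdot>\<^bsub>A\<^esub> bracket A (permute_list \<sigma> xs)"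
    and bracket_jacobi:
      "\<lbrakk>length xs = n; set xs \<subseteq> carrier A; length ys = n - 1; set ys \<subseteq> carrier A\<rbrakk> \<Longrightarrow>
        bracket A (bracket A xs # ys) =
          (\<Oplus>\<^bsub>A\<^esub>i\<in>{..<n}. bracket A (xs[i := bracket A ((xs ! i) # ys)]))"

definition nlie_subalgebra ::
  "('k, 'm) ring_scheme \<Rightarrow> ('k, 'v, 'z) nlie_scheme \<Rightarrow> nat \<Rightarrow> 'v set \<Rightarrow> bool" where
  "nlie_subalgebra K A n B \<longleftrightarrow>
     subspace K B A \<and> (\<forall>xs. length xs = n \<and> set xs \<subseteq> B \<longrightarrow> bracket A xs \<in> B)"

definition nlie_ideal ::
  "('k, 'm) ring_scheme \<Rightarrow> ('k, 'v, 'z) nlie_scheme \<Rightarrow> nat \<Rightarrow> 'v set \<Rightarrow> bool" where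
  "nlie_ideal K A n I \<longleftrightarrow>
     subspace K I A \<and>
     (\<forall>x\<in>I. \<forall>ys. length ys = n - 1 \<and> set ys \<subseteq> carrier A \<longrightarrow> bracket A (x # ys) \<in> I)"

definition maximal_subalgebra ::
  "('k, 'm) ring_scheme \<Rightarrow> ('k, 'v, 'z) nlie_scheme \<Rightarrow> nat \<Rightarrow> 'v set \<Rightarrow> bool" where
  "maximal_subalgebra K A n M \<longleftrightarrow>
     nlie_subalgebra K A n M \<and> M \<noteq> carrier A \<and>
     (\<forall>B. nlie_subalgebra K A n B \<and> M \<subset> B \<longrightarrow> B = carrier A)"

text \<open>
  An algebra without maximal subalgebras is its own Frattini subalgebra; in particular this
  gives the convention \<open>F(0) = 0\<close>.
\<close>

definition frattini ::
  "('k, 'm) ring_scheme \<Rightarrow> ('k, 'v, 'z) nlie_scheme \<Rightarrow> nat \<Rightarrow> 'v set" where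
  "frattini K A n = carrier A \<inter> \<Inter>{M. maximal_subalgebra K A n M}"

definition frattini_ideal ::
  "('k, 'm) ring_scheme \<Rightarrow> ('k, 'v, 'z) nlie_scheme \<Rightarrow> nat \<Rightarrow> 'v set" where
  "frattini_ideal K A n = (GREATEST I. nlie_ideal K A n I \<and> I \<subseteq> frattini K A n)"

definition elementary_nlie_algebra ::
  "('k, 'm) ring_scheme \<Rightarrow> ('k, 'v, 'z) nlie_scheme \<Rightarrow> nat \<Rightarrow> bool" where
  "elementary_nlie_algebra K A n \<longleftrightarrow>
     nlie_algebra K A n \<and>
     (\<forall>C. nlie_subalgebra K A n C \<longrightarrow> frattini_ideal K (A\<lparr>carrier := C\<rparr>) n = {\<zero>\<^bsub>A\<^esub>})"

text \<open>
  The quotient is built on additive cosets in the style of \<^const>\<open>FactRing\<close>: operations are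
  applied to all representatives, and \<^term>\<open>listset Xs\<close> is the set of all lists of representatives
  of the list of cosets \<open>Xs\<close>.
\<close>

definition nlie_quotient :: "('k, 'v, 'z) nlie_scheme \<Rightarrow> 'v set \<Rightarrow> ('k, 'v set) nlie" where
  "nlie_quotient A I =
     \<lparr>carrier = a_rcosets\<^bsub>A\<^esub> I, mult = (\<lambda>X Y. I), one = I, zero = I, add = set_add A,
      smult = (\<lambda>c X. \<Union>x\<in>X. I +>\<^bsub>A\<^esub> (c \<odot>\<^bsub>A\<^esub> x)),
      bracket = (\<lambda>Xs. \<Union>xs\<in>listset Xs. I +>\<^bsub>A\<^esub> bracket A xs)\<rparr>"

definition nlie_direct_sum ::
  "'i set \<Rightarrow> ('i \<Rightarrow> ('k, 'v, 'z) nlie_scheme) \<Rightarrow> ('k, 'i \<Rightarrow> 'v) nlie" where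
  "nlie_direct_sum J S =
     \<lparr>carrier = (\<Pi>\<^sub>E i\<in>J. carrier (S i)),
      mult = (\<lambda>f g. \<lambda>i\<in>J. \<zero>\<^bsub>S i\<^esub>), one = (\<lambda>i\<in>J. \<zero>\<^bsub>S i\<^esub>),
      zero = (\<lambda>i\<in>J. \<zero>\<^bsub>S i\<^esub>), add = (\<lambda>f g. \<lambda>i\<in>J. f i \<oplus>\<^bsub>S i\<^esub> g i),
      smult = (\<lambda>c f. \<lambda>i\<in>J. c \<odot>\<^bsub>S i\<^esub> f i),
      bracket = (\<lambda>fs. \<lambda>i\<in>J. bracket (S i) (map (\<lambda>f. f i) fs))\<rparr>"

text \<open>The largest ideal inside the Frattini subalgebra exists, so \<^const>\<open>frattini_ideal\<close> is it.\<close>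

lemma (in nlie_algebra) nlie_ideal_zero: "nlie_ideal K A n {\<zero>\<^bsub>A\<^esub>}"
proof -
  have "subspace K {\<zero>\<^bsub>A\<^esub>} A"
    by (rule subspace.intro[OF vectorspace_axioms], rule submodule.intro[OF module_axioms]) auto
  moreover have "bracket A (\<zero>\<^bsub>A\<^esub> # ys) = \<zero>\<^bsub>A\<^esub>" if "length ys = n - 1" "set ys \<subseteq> carrier A" for ys
  proof -
    have l: "length (\<zero>\<^bsub>A\<^esub> # ys) = n" "set (\<zero>\<^bsub>A\<^esub> # ys) \<subseteq> carrier A"
      using that n_ge_2 by auto
    have "bracket A (\<zero>\<^bsub>A\<^esub> # ys) = \<zero>\<^bsub>K\<^esub> \<odot>\<^bsub>A\<^esub> bracket A (\<zero>\<^bsub>A\<^esub> # ys)"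
      using bracket_smult[OF l, of 0 "\<zero>\<^bsub>K\<^esub>" "\<zero>\<^bsub>A\<^esub>"] n_ge_2 by simp
    then show ?thesis
      using bracket_closed[OF l] by simp
  qed
  ultimately show ?thesis
    unfolding nlie_ideal_def by auto
qed

lemma (in nlie_algebra) nlie_ideal_sum:
  assumes "nlie_ideal K A n I" "nlie_ideal K A n J"
  shows "nlie_ideal K A n (submodule_sum I J)"
proof -
  have sm: "submodule K I A" "submodule K J A"
    using assms unfolding nlie_ideal_def subspace_def by auto
  then have sub: "I \<subseteq> carrier A" "J \<subseteq> carrier A"
    using submodule.subset by blast+
  have "bracket A ((x \<oplus>\<^bsub>A\<^esub> y) # ys) \<in> submodule_sum I J"
    if xy: "x \<in> I" "y \<in> J" and ys: "length ys = n - 1" "set ys \<subseteq> carrier A" for x y ys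
  proof -
    have c: "x \<in> carrier A" "y \<in> carrier A" using xy sub by auto
    have l: "length (x # ys) = n" "set (x # ys) \<subseteq> carrier A"
      using ys n_ge_2 c by auto
    have "bracket A ((x \<oplus>\<^bsub>A\<^esub> y) # ys) = bracket A (x # ys) \<oplus>\<^bsub>A\<^esub> bracket A (y # ys)"
      using bracket_add[OF l, of 0 x y] n_ge_2 c by simp
    moreover have "bracket A (x # ys) \<in> I" "bracket A (y # ys) \<in> J"
      using assms xy ys unfolding nlie_ideal_def by auto
    ultimately show ?thesis
      unfolding submodule_sum_def by auto
  qed
  moreover have "subspace K (submodule_sum I J) A"
    by (rule subspace.intro[OF vectorspace_axioms sum_is_submodule[OF sm]])
  ultimately show ?thesis
    unfolding nlie_ideal_def submodule_sum_def by auto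
qed

lemma (in nlie_algebra) frattini_ideal_largest:
  "nlie_ideal K A n (frattini_ideal K A n)"
  "frattini_ideal K A n \<subseteq> frattini K A n"
  "\<lbrakk>nlie_ideal K A n I; I \<subseteq> frattini K A n\<rbrakk> \<Longrightarrow> I \<subseteq> frattini_ideal K A n"
proof -
  define P where "P = (\<lambda>I. nlie_ideal K A n I \<and> I \<subseteq> frattini K A n)"
  have sm: "submodule K I A" if "nlie_ideal K A n I" for I
    using that unfolding nlie_ideal_def subspace_def by auto
  have smM: "submodule K M A" if "maximal_subalgebra K A n M" for M
    using that unfolding maximal_subalgebra_def nlie_subalgebra_def subspace_def by auto
  have F_zero: "\<zero>\<^bsub>A\<^esub> \<in> frattini K A n"
    unfolding frattini_def using submodule.zero_closed[OF smM] by auto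
  have F_add: "x \<oplus>\<^bsub>A\<^esub> y \<in> frattini K A n" if "x \<in> frattini K A n" "y \<in> frattini K A n" for x y
    using that submodule.m_closed[OF smM] unfolding frattini_def by auto
  have P0: "P {\<zero>\<^bsub>A\<^esub>}"
    unfolding P_def using nlie_ideal_zero F_zero by auto
  have Psum: "\<exists>L. P L \<and> I \<subseteq> L \<and> J \<subseteq> L" if "P I" "P J" for I J
  proof (intro exI conjI)
    have i: "nlie_ideal K A n I" "nlie_ideal K A n J"
      using that unfolding P_def by auto
    show "P (submodule_sum I J)"
      using that nlie_ideal_sum[OF i] F_add unfolding P_def submodule_sum_def by auto
    show "I \<subseteq> submodule_sum I J" by (rule in_sum[OF sm sm]) (use i in auto)
    show "J \<subseteq> submodule_sum I J"
    proof
      fix y assume y: "y \<in> J"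
      then have "y = \<zero>\<^bsub>A\<^esub> \<oplus>\<^bsub>A\<^esub> y"
        using submodule.subset[OF sm[OF i(2)]] by auto
      then show "y \<in> submodule_sum I J"
        unfolding submodule_sum_def
        using y submodule.zero_closed[OF sm[OF i(1)]]
        by (intro image_eqI[where x = "(\<zero>\<^bsub>A\<^esub>, y)"]) auto
    qed
  qed
  define U where "U = \<Union>(Collect P)"
  have "submodule K U A"
  proof (rule submodule.intro[OF module_axioms])
    show "U \<subseteq> carrier A" unfolding U_def P_def frattini_def by auto
    show "\<zero>\<^bsub>A\<^esub> \<in> U" unfolding U_def using P0 by auto
  next
    fix v w assume "v \<in> U" "w \<in> U"
    then obtain L where "P L" "v \<in> L" "w \<in> L"
      unfolding U_def using Psum by blast
    moreover from this have "v \<oplus>\<^bsub>A\<^esub> w \<in> L"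
      using submodule.m_closed[OF sm] unfolding P_def by auto
    ultimately show "v \<oplus>\<^bsub>A\<^esub> w \<in> U" unfolding U_def by auto
  next
    fix c v assume "c \<in> carrier K" "v \<in> U"
    then show "c \<odot>\<^bsub>A\<^esub> v \<in> U"
      unfolding U_def using submodule.smult_closed[OF sm] unfolding P_def by blast
  qed
  then have "P U"
    unfolding P_def nlie_ideal_def subspace_def using vectorspace_axioms
    by (auto simp: U_def P_def nlie_ideal_def)
  then have "P (frattini_ideal K A n) \<and> (\<forall>I. P I \<longrightarrow> I \<subseteq> frattini_ideal K A n)"
    unfolding frattini_ideal_def P_def[symmetric]
    using GreatestI2_order[of P U "\<lambda>x. P x \<and> (\<forall>I. P I \<longrightarrow> I \<subseteq> x)"] U_def by blast
  then show "nlie_ideal K A n (frattini_ideal K A n)"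
    "frattini_ideal K A n \<subseteq> frattini K A n"
    "\<lbrakk>nlie_ideal K A n I; I \<subseteq> frattini K A n\<rbrakk> \<Longrightarrow> I \<subseteq> frattini_ideal K A n"
    unfolding P_def by auto
qed

end

theory Submission
  imports Defs
begin

text \<open>
  Write \<open>\<Phi>(A)\<close> for the largest ideal inside the Frattini subalgebra \<open>F(A)\<close>.  The theorem rests
  on one fact about homomorphisms and one construction of subalgebras.

  The preimage of a maximal subalgebra under a surjective homomorphism \<open>f : A \<rightarrow> B\<close> is again
  maximal, so \<open>f\<close> maps \<open>F(A)\<close> into \<open>F(B)\<close>; it also maps ideals to ideals, and hence \<open>\<Phi>(A)\<close>
  into \<open>\<Phi>(B)\<close> (\<open>nlie_hom_frattini_ideal\<close>).  Let now \<open>C\<close> be a subalgebra of an arbitrary \<open>B\<close>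
  and let \<open>f\<close> be a homomorphism from \<open>B\<close> to an elementary algebra \<open>S\<close>.  Then
  \<open>f(\<Phi>(C)) \<subseteq> \<Phi>(f(C)) = 0\<close>, since \<open>f(C)\<close> is a subalgebra of \<open>S\<close>.  So if homomorphisms to
  elementary algebras separate the points of \<open>B\<close>, then \<open>B\<close> is elementary
  (\<open>elementary_if_separated\<close>).  The projections of a direct sum separate its points, which
  settles direct sums.  Subalgebras are elementary because a subalgebra of a subalgebra is a
  subalgebra.

  For a quotient \<open>A/I\<close> the separating family consists of a single injective homomorphism into
  \<open>A\<close>.  To find it, take a subalgebra \<open>C\<close> that is minimal subject to \<open>A = I + C\<close>; finite
  dimension provides one.  If some maximal subalgebra \<open>M\<close> of \<open>C\<close> did not contain \<open>I \<inter> C\<close>, then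
  \<open>(I + M) \<inter> C\<close> would be a subalgebra of \<open>C\<close> larger than \<open>M\<close>, hence equal to \<open>C\<close>, and
  \<open>A = I + C = I + M\<close> would contradict minimality.  So \<open>I \<inter> C\<close>, an ideal of \<open>C\<close>, lies in
  \<open>\<Phi>(C)\<close> (\<open>ex_frattini_supplement\<close>), and \<open>\<Phi>(C) = 0\<close> as \<open>A\<close> is elementary.  Thus \<open>C\<close> is a
  complement of \<open>I\<close>, and \<open>A/I\<close> embeds into \<open>A\<close> as \<open>C\<close>.
\<close>

section \<open>Closed operations and homomorphisms\<close>

text \<open>
  Closure of the carrier under the operations, with none of the laws.  Subalgebras are the
  subsets with this property, and the laws on a structure that has it can be pulled back along
  homomorphisms.
\<close>

definition closed_operations ::
  "('k, 'm) ring_scheme \<Rightarrow> ('k, 'v, 'z) nlie_scheme \<Rightarrow> nat \<Rightarrow> bool" where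
  "closed_operations K A n \<longleftrightarrow>
     \<zero>\<^bsub>A\<^esub> \<in> carrier A \<and>
     (\<forall>x\<in>carrier A. \<forall>y\<in>carrier A. x \<oplus>\<^bsub>A\<^esub> y \<in> carrier A) \<and>
     (\<forall>c\<in>carrier K. \<forall>x\<in>carrier A. c \<odot>\<^bsub>A\<^esub> x \<in> carrier A) \<and>
     (\<forall>xs. length xs = n \<and> set xs \<subseteq> carrier A \<longrightarrow> bracket A xs \<in> carrier A)"

text \<open>
  No law is assumed on either side, so that a map can be called a homomorphism before its source
  is known to be an algebra; without additive inverses, preservation of zero has to be required
  separately.
\<close>

definition nlie_hom ::
  "('k, 'm) ring_scheme \<Rightarrow> ('k, 'v, 'y) nlie_scheme \<Rightarrow> ('k, 'w, 'z) nlie_scheme \<Rightarrow> nat \<Rightarrow>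
    ('v \<Rightarrow> 'w) \<Rightarrow> bool" where
  "nlie_hom K A B n f \<longleftrightarrow>
     f ` carrier A \<subseteq> carrier B \<and> f \<zero>\<^bsub>A\<^esub> = \<zero>\<^bsub>B\<^esub> \<and>
     (\<forall>x\<in>carrier A. \<forall>y\<in>carrier A. f (x \<oplus>\<^bsub>A\<^esub> y) = f x \<oplus>\<^bsub>B\<^esub> f y) \<and>
     (\<forall>c\<in>carrier K. \<forall>x\<in>carrier A. f (c \<odot>\<^bsub>A\<^esub> x) = c \<odot>\<^bsub>B\<^esub> f x) \<and>
     (\<forall>xs. length xs = n \<and> set xs \<subseteq> carrier A \<longrightarrow>
        f (bracket A xs) = bracket B (map f xs))"

lemma closed_operationsD:
  assumes "closed_operations K A n"
  shows "\<zero>\<^bsub>A\<^esub> \<in> carrier A"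
    and "\<lbrakk>x \<in> carrier A; y \<in> carrier A\<rbrakk> \<Longrightarrow> x \<oplus>\<^bsub>A\<^esub> y \<in> carrier A"
    and "\<lbrakk>c \<in> carrier K; x \<in> carrier A\<rbrakk> \<Longrightarrow> c \<odot>\<^bsub>A\<^esub> x \<in> carrier A"
    and "\<lbrakk>length xs = n; set xs \<subseteq> carrier A\<rbrakk> \<Longrightarrow> bracket A xs \<in> carrier A"
  using assms unfolding closed_operations_def by auto

lemma nlie_homD:
  assumes "nlie_hom K A B n f"
  shows "x \<in> carrier A \<Longrightarrow> f x \<in> carrier B"
    and "f \<zero>\<^bsub>A\<^esub> = \<zero>\<^bsub>B\<^esub>"
    and "\<lbrakk>x \<in> carrier A; y \<in> carrier A\<rbrakk> \<Longrightarrow> f (x \<oplus>\<^bsub>A\<^esub> y) = f x \<oplus>\<^bsub>B\<^esub> f y"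
    and "\<lbrakk>c \<in> carrier K; x \<in> carrier A\<rbrakk> \<Longrightarrow> f (c \<odot>\<^bsub>A\<^esub> x) = c \<odot>\<^bsub>B\<^esub> f x"
    and "\<lbrakk>length xs = n; set xs \<subseteq> carrier A\<rbrakk> \<Longrightarrow> f (bracket A xs) = bracket B (map f xs)"
  using assms unfolding nlie_hom_def by auto

lemma nlie_subalgebra_iff:
  assumes "nlie_algebra K A n"
  shows "nlie_subalgebra K A n C \<longleftrightarrow> C \<subseteq> carrier A \<and> closed_operations K (A\<lparr>carrier := C\<rparr>) n"
proof -
  interpret nlie_algebra K A n by fact
  show ?thesis
    using module_axioms vectorspace_axioms
    unfolding nlie_subalgebra_def closed_operations_def subspace_def submodule_def
    by auto
qed

lemma nlie_ideal_iff:
  assumes "nlie_algebra K A n"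
  shows "nlie_ideal K A n I \<longleftrightarrow> I \<subseteq> carrier A \<and> \<zero>\<^bsub>A\<^esub> \<in> I \<and>
     (\<forall>x\<in>I. \<forall>y\<in>I. x \<oplus>\<^bsub>A\<^esub> y \<in> I) \<and> (\<forall>c\<in>carrier K. \<forall>x\<in>I. c \<odot>\<^bsub>A\<^esub> x \<in> I) \<and>
     (\<forall>x\<in>I. \<forall>ys. length ys = n - 1 \<and> set ys \<subseteq> carrier A \<longrightarrow> bracket A (x # ys) \<in> I)"
proof -
  interpret nlie_algebra K A n by fact
  show ?thesis
    using module_axioms vectorspace_axioms
    unfolding nlie_ideal_def subspace_def submodule_def
    by auto
qed

section \<open>Structures separated by homomorphisms\<close>

text \<open>
  Each law is an equation between two elements of \<open>B\<close>, and every \<open>f i\<close> identifies its two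
  sides because the law holds in \<open>S i\<close>.  The existence of additive inverses becomes an equation
  as well once the inverse of \<open>x\<close> is named as \<open>(-1) x\<close>.
\<close>

lemma vectorspace_if_separated:
  fixes B :: "('k, 'v, 'y) nlie_scheme" and S :: "'i \<Rightarrow> ('k, 'w, 'z) nlie_scheme"
  assumes "field K"
    and closed: "closed_operations K B n"
    and hom: "\<And>i. i \<in> J \<Longrightarrow> nlie_hom K B (S i) n (f i)"
    and alg: "\<And>i. i \<in> J \<Longrightarrow> vectorspace K (S i)"
    and sep: "\<And>x y. \<lbrakk>x \<in> carrier B; y \<in> carrier B; \<And>i. i \<in> J \<Longrightarrow> f i x = f i y\<rbrakk> \<Longrightarrow> x = y"
  shows "vectorspace K B"
proof -
  interpret K: field K by fact
  have m: "module K (S i)" if "i \<in> J" for i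
    using alg[OF that] by (simp add: vectorspace_def)
  then have g: "abelian_group (S i)" if "i \<in> J" for i
    using that by (simp add: module_def)
  have [simp]: "\<zero>\<^bsub>B\<^esub> \<in> carrier B" "x \<in> carrier B \<Longrightarrow> y \<in> carrier B \<Longrightarrow> x \<oplus>\<^bsub>B\<^esub> y \<in> carrier B"
    "c \<in> carrier K \<Longrightarrow> x \<in> carrier B \<Longrightarrow> c \<odot>\<^bsub>B\<^esub> x \<in> carrier B" for c x y
    using closed unfolding closed_operations_def by auto
  have [simp]: "f i \<zero>\<^bsub>B\<^esub> = \<zero>\<^bsub>S i\<^esub>" "x \<in> carrier B \<Longrightarrow> f i x \<in> carrier (S i)"
    "x \<in> carrier B \<Longrightarrow> y \<in> carrier B \<Longrightarrow> f i (x \<oplus>\<^bsub>B\<^esub> y) = f i x \<oplus>\<^bsub>S i\<^esub> f i y"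
    "c \<in> carrier K \<Longrightarrow> x \<in> carrier B \<Longrightarrow> f i (c \<odot>\<^bsub>B\<^esub> x) = c \<odot>\<^bsub>S i\<^esub> f i x"
    if "i \<in> J" for i c x y
    using hom[OF that] unfolding nlie_hom_def by auto
  have "abelian_group B"
  proof (rule abelian_groupI)
    fix x assume x: "x \<in> carrier B"
    show "\<exists>y\<in>carrier B. y \<oplus>\<^bsub>B\<^esub> x = \<zero>\<^bsub>B\<^esub>"
    proof
      show "(\<ominus>\<^bsub>K\<^esub> \<one>\<^bsub>K\<^esub>) \<odot>\<^bsub>B\<^esub> x \<oplus>\<^bsub>B\<^esub> x = \<zero>\<^bsub>B\<^esub>"
      proof (rule sep)
        fix i assume i: "i \<in> J"
        interpret Si: module K "S i" by (rule m[OF i])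
        show "f i ((\<ominus>\<^bsub>K\<^esub> \<one>\<^bsub>K\<^esub>) \<odot>\<^bsub>B\<^esub> x \<oplus>\<^bsub>B\<^esub> x) = f i \<zero>\<^bsub>B\<^esub>"
          using i x by (simp add: Si.smult_l_minus Si.l_neg)
      qed (use x in auto)
    qed (use x in auto)
  next
    fix x y z assume a: "x \<in> carrier B" "y \<in> carrier B" "z \<in> carrier B"
    show "x \<oplus>\<^bsub>B\<^esub> y \<oplus>\<^bsub>B\<^esub> z = x \<oplus>\<^bsub>B\<^esub> (y \<oplus>\<^bsub>B\<^esub> z)"
      by (rule sep) (simp_all add: a abelian_groupE(3)[OF g])
  next
    fix x y assume a: "x \<in> carrier B" "y \<in> carrier B"
    show "x \<oplus>\<^bsub>B\<^esub> y = y \<oplus>\<^bsub>B\<^esub> x"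
      by (rule sep) (simp_all add: a abelian_groupE(4)[OF g])
  next
    fix x assume a: "x \<in> carrier B"
    show "\<zero>\<^bsub>B\<^esub> \<oplus>\<^bsub>B\<^esub> x = x"
      by (rule sep) (simp_all add: a abelian_groupE(5)[OF g])
  qed simp_all
  then have "module K B"
  proof (rule moduleI[OF K.is_cring])
    fix c d x assume a: "c \<in> carrier K" "d \<in> carrier K" "x \<in> carrier B"
    show "(c \<oplus>\<^bsub>K\<^esub> d) \<odot>\<^bsub>B\<^esub> x = c \<odot>\<^bsub>B\<^esub> x \<oplus>\<^bsub>B\<^esub> d \<odot>\<^bsub>B\<^esub> x"
      by (rule sep) (simp_all add: a module.smult_l_distr[OF m])
    show "(c \<otimes>\<^bsub>K\<^esub> d) \<odot>\<^bsub>B\<^esub> x = c \<odot>\<^bsub>B\<^esub> (d \<odot>\<^bsub>B\<^esub> x)"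
      by (rule sep) (simp_all add: a module.smult_assoc1[OF m])
  next
    fix c x y assume a: "c \<in> carrier K" "x \<in> carrier B" "y \<in> carrier B"
    show "c \<odot>\<^bsub>B\<^esub> (x \<oplus>\<^bsub>B\<^esub> y) = c \<odot>\<^bsub>B\<^esub> x \<oplus>\<^bsub>B\<^esub> c \<odot>\<^bsub>B\<^esub> y"
      by (rule sep) (simp_all add: a module.smult_r_distr[OF m])
  next
    fix x assume a: "x \<in> carrier B"
    show "\<one>\<^bsub>K\<^esub> \<odot>\<^bsub>B\<^esub> x = x"
      by (rule sep) (simp_all add: a module.smult_one[OF m])
  qed simp_all
  then show ?thesis
    using \<open>field K\<close> by (simp add: vectorspace_def)
qed

text \<open>
  The same argument for the laws of the bracket.  It needs that the homomorphisms also commute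
  with the integer multiples and the finite sums that occur in these laws.
\<close>

lemma nlie_algebra_if_separated:
  fixes B :: "('k, 'v, 'y) nlie_scheme" and S :: "'i \<Rightarrow> ('k, 'w, 'z) nlie_scheme"
  assumes K: "field K" and n: "2 \<le> n"
    and closed: "closed_operations K B n"
    and hom: "\<And>i. i \<in> J \<Longrightarrow> nlie_hom K B (S i) n (f i)"
    and alg: "\<And>i. i \<in> J \<Longrightarrow> nlie_algebra K (S i) n"
    and sep: "\<And>x y. \<lbrakk>x \<in> carrier B; y \<in> carrier B; \<And>i. i \<in> J \<Longrightarrow> f i x = f i y\<rbrakk> \<Longrightarrow> x = y"
  shows "nlie_algebra K B n"
proof -
  have vs: "vectorspace K (S i)" if "i \<in> J" for i
    using alg[OF that] by (simp add: nlie_algebra_def)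
  interpret B: vectorspace K B
    by (rule vectorspace_if_separated[OF K closed hom vs sep])
  have br[simp]: "length xs = n \<Longrightarrow> set xs \<subseteq> carrier B \<Longrightarrow> bracket B xs \<in> carrier B" for xs
    using closed unfolding closed_operations_def by auto
  have hs: "x \<in> carrier B \<Longrightarrow> f i x \<in> carrier (S i)"
    "x \<in> carrier B \<Longrightarrow> y \<in> carrier B \<Longrightarrow> f i (x \<oplus>\<^bsub>B\<^esub> y) = f i x \<oplus>\<^bsub>S i\<^esub> f i y"
    "c \<in> carrier K \<Longrightarrow> x \<in> carrier B \<Longrightarrow> f i (c \<odot>\<^bsub>B\<^esub> x) = c \<odot>\<^bsub>S i\<^esub> f i x"
    "length xs = n \<Longrightarrow> set xs \<subseteq> carrier B \<Longrightarrow> f i (bracket B xs) = bracket (S i) (map (f i) xs)"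
    "set xs \<subseteq> carrier B \<Longrightarrow> f i ` set xs \<subseteq> carrier (S i)"
    "f i \<zero>\<^bsub>B\<^esub> = \<zero>\<^bsub>S i\<^esub>"
    if "i \<in> J" for i c x y xs
    using hom[OF that] unfolding nlie_hom_def by auto
  have upd: "set (xs[j := x]) \<subseteq> carrier B" if "set xs \<subseteq> carrier B" "x \<in> carrier B" for xs x j
    using that set_update_subset_insert[of xs j x] by auto
  show ?thesis
  proof
    show "2 \<le> n" by fact
  next
    fix xs assume "length xs = n" "set xs \<subseteq> carrier B"
    then show "bracket B xs \<in> carrier B" by simp
  next
    fix xs j x y
    assume a: "length xs = n" "set xs \<subseteq> carrier B" "j < n" "x \<in> carrier B" "y \<in> carrier B"
    show "bracket B (xs[j := x \<oplus>\<^bsub>B\<^esub> y]) = bracket B (xs[j := x]) \<oplus>\<^bsub>B\<^esub> bracket B (xs[j := y])"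
    proof (rule sep)
      fix i assume i: "i \<in> J"
      interpret Si: nlie_algebra K "S i" n by (rule alg[OF i])
      show "f i (bracket B (xs[j := x \<oplus>\<^bsub>B\<^esub> y])) =
          f i (bracket B (xs[j := x]) \<oplus>\<^bsub>B\<^esub> bracket B (xs[j := y]))"
        using a hs[OF i] Si.bracket_add[of "map (f i) xs" j "f i x" "f i y"]
        by (simp add: upd map_update)
    qed (use a in \<open>simp_all add: upd\<close>)
  next
    fix xs j c x
    assume a: "length xs = n" "set xs \<subseteq> carrier B" "j < n" "c \<in> carrier K" "x \<in> carrier B"
    show "bracket B (xs[j := c \<odot>\<^bsub>B\<^esub> x]) = c \<odot>\<^bsub>B\<^esub> bracket B (xs[j := x])"
    proof (rule sep)
      fix i assume i: "i \<in> J"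
      interpret Si: nlie_algebra K "S i" n by (rule alg[OF i])
      show "f i (bracket B (xs[j := c \<odot>\<^bsub>B\<^esub> x])) = f i (c \<odot>\<^bsub>B\<^esub> bracket B (xs[j := x]))"
        using a hs[OF i] Si.bracket_smult[of "map (f i) xs" j c "f i x"]
        by (simp add: upd map_update)
    qed (use a in \<open>simp_all add: upd\<close>)
  next
    fix xs \<sigma>
    assume a: "length xs = n" "set xs \<subseteq> carrier B" "\<sigma> permutes {..<n}"
    have p: "set (permute_list \<sigma> xs) = set xs"
      using a by (intro set_permute_list) auto
    show "bracket B xs = [sign \<sigma>] \<cdot>\<^bsub>B\<^esub> bracket B (permute_list \<sigma> xs)"
    proof (rule sep)
      fix i assume i: "i \<in> J"
      interpret Si: nlie_algebra K "S i" n by (rule alg[OF i])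
      interpret h: group_hom "add_monoid B" "add_monoid (S i)" "f i"
        by unfold_locales (auto simp: hom_def hs[OF i])
      have "f i ([sign \<sigma>] \<cdot>\<^bsub>B\<^esub> bracket B (permute_list \<sigma> xs)) =
          [sign \<sigma>] \<cdot>\<^bsub>S i\<^esub> f i (bracket B (permute_list \<sigma> xs))"
        unfolding add_pow_def using a p by (intro h.hom_int_pow) simp
      also have "\<dots> = [sign \<sigma>] \<cdot>\<^bsub>S i\<^esub> bracket (S i) (permute_list \<sigma> (map (f i) xs))"
        using a p hs[OF i] by (simp add: permute_list_map)
      also have "\<dots> = f i (bracket B xs)"
        using a hs[OF i] Si.bracket_permute[of "map (f i) xs" \<sigma>] by simp
      finally show "f i (bracket B xs) = f i ([sign \<sigma>] \<cdot>\<^bsub>B\<^esub> bracket B (permute_list \<sigma> xs))" ..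
    qed (use a p in simp_all)
  next
    fix xs ys
    assume a: "length xs = n" "set xs \<subseteq> carrier B" "length ys = n - 1" "set ys \<subseteq> carrier B"
    have Bxj: "bracket B (xs ! j # ys) \<in> carrier B" if "j < n" for j
      using a that n by (intro br) auto
    then have t: "bracket B (xs[j := bracket B (xs ! j # ys)]) \<in> carrier B" if "j < n" for j
      using that a by (simp add: upd)
    show "bracket B (bracket B xs # ys) =
        (\<Oplus>\<^bsub>B\<^esub>j\<in>{..<n}. bracket B (xs[j := bracket B (xs ! j # ys)]))"
    proof (rule sep)
      fix i assume i: "i \<in> J"
      interpret Si: nlie_algebra K "S i" n by (rule alg[OF i])
      have f_sum: "f i (\<Oplus>\<^bsub>B\<^esub>j\<in>N. g j) = (\<Oplus>\<^bsub>S i\<^esub>j\<in>N. f i (g j))"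
        if "finite N" "g \<in> N \<rightarrow> carrier B" for g :: "nat \<Rightarrow> 'v" and N
        using that by (induction N) (simp_all add: hs[OF i] Pi_def)
      have "f i (bracket B (bracket B xs # ys)) =
          bracket (S i) (bracket (S i) (map (f i) xs) # map (f i) ys)"
        using a n hs[OF i] by simp
      also have "\<dots> = (\<Oplus>\<^bsub>S i\<^esub>j\<in>{..<n}. bracket (S i)
          ((map (f i) xs)[j := bracket (S i) (map (f i) xs ! j # map (f i) ys)]))"
        using a hs[OF i] by (intro Si.bracket_jacobi) simp_all
      also have "\<dots> = (\<Oplus>\<^bsub>S i\<^esub>j\<in>{..<n}. f i (bracket B (xs[j := bracket B (xs ! j # ys)])))"
      proof (rule Si.finsum_cong')
        fix j assume j: "j \<in> {..<n}"
        have "xs ! j \<in> carrier B"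
          using a j nth_mem[of j xs] by auto
        then have "f i (bracket B (xs ! j # ys)) = bracket (S i) (map (f i) xs ! j # map (f i) ys)"
          using a n j hs[OF i] by simp
        then show "bracket (S i)
            ((map (f i) xs)[j := bracket (S i) (map (f i) xs ! j # map (f i) ys)]) =
            f i (bracket B (xs[j := bracket B (xs ! j # ys)]))"
          using a j hs[OF i] Bxj[of j] by (simp add: upd map_update)
      qed (use t hs[OF i] in auto)
      also have "\<dots> = f i (\<Oplus>\<^bsub>B\<^esub>j\<in>{..<n}. bracket B (xs[j := bracket B (xs ! j # ys)]))"
        using t by (subst f_sum) auto
      finally show "f i (bracket B (bracket B xs # ys)) =
          f i (\<Oplus>\<^bsub>B\<^esub>j\<in>{..<n}. bracket B (xs[j := bracket B (xs ! j # ys)]))" .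
    next
      show "bracket B (bracket B xs # ys) \<in> carrier B"
        using a n by (intro br) auto
      show "(\<Oplus>\<^bsub>B\<^esub>j\<in>{..<n}. bracket B (xs[j := bracket B (xs ! j # ys)])) \<in> carrier B"
        using t by (intro B.finsum_closed) auto
    qed
  qed
qed

section \<open>Subalgebras and ideals under homomorphisms\<close>

lemma nlie_algebra_subalgebra:
  assumes alg: "nlie_algebra K A n" and C: "nlie_subalgebra K A n C"
  shows "nlie_algebra K (A\<lparr>carrier := C\<rparr>) n"
proof -
  interpret nlie_algebra K A n by fact
  have C': "C \<subseteq> carrier A" "closed_operations K (A\<lparr>carrier := C\<rparr>) n"
    using C nlie_subalgebra_iff[OF alg] by auto
  then have "nlie_hom K (A\<lparr>carrier := C\<rparr>) A n (\<lambda>x. x)"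
    unfolding nlie_hom_def by auto
  then show ?thesis
    using nlie_algebra_if_separated[OF field_axioms n_ge_2 C'(2),
        where J = "{()}" and S = "\<lambda>_. A" and f = "\<lambda>_ x. x"] alg
    by blast
qed

lemma nlie_subalgebra_subalgebra_iff:
  assumes alg: "nlie_algebra K A n" and C: "nlie_subalgebra K A n C"
  shows "nlie_subalgebra K (A\<lparr>carrier := C\<rparr>) n D \<longleftrightarrow> nlie_subalgebra K A n D \<and> D \<subseteq> C"
  using C
  unfolding nlie_subalgebra_iff[OF alg] nlie_subalgebra_iff[OF nlie_algebra_subalgebra[OF alg C]]
  by auto

lemma elementary_subalgebra:
  assumes A: "elementary_nlie_algebra K A n" and B: "nlie_subalgebra K A n B"
  shows "elementary_nlie_algebra K (A\<lparr>carrier := B\<rparr>) n"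
proof -
  have alg: "nlie_algebra K A n" using A unfolding elementary_nlie_algebra_def by blast
  show ?thesis
    using A unfolding elementary_nlie_algebra_def nlie_subalgebra_subalgebra_iff[OF alg B]
    by (simp add: nlie_algebra_subalgebra[OF alg B])
qed

text \<open>
  An image is closed under the bracket, and the image of an ideal absorbs, because lists of
  arguments lift entry by entry.
\<close>

lemma map_lift_list:
  assumes "set ys \<subseteq> f ` C"
  obtains xs where "set xs \<subseteq> C" "map f xs = ys"
proof -
  have "set (map (inv_into C f) ys) \<subseteq> C" "map f (map (inv_into C f) ys) = ys"
    using assms by (auto intro: inv_into_into map_idI simp: f_inv_into_f subset_iff)
  then show ?thesis using that by blast
qed

lemma nlie_hom_image_subalgebra:
  assumes algA: "nlie_algebra K A n" and algB: "nlie_algebra K B n"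
    and hom: "nlie_hom K A B n f" and C: "nlie_subalgebra K A n C"
  shows "nlie_subalgebra K B n (f ` C)"
proof -
  have CA: "C \<subseteq> carrier A" and clC: "closed_operations K (A\<lparr>carrier := C\<rparr>) n"
    using C nlie_subalgebra_iff[OF algA] by auto
  note cl = closed_operationsD[OF clC, simplified] and h = nlie_homD[OF hom]
  have "bracket B ys \<in> f ` C" if ys: "length ys = n" "set ys \<subseteq> f ` C" for ys
  proof -
    obtain xs where xs: "set xs \<subseteq> C" "map f xs = ys" using map_lift_list[OF ys(2)] .
    with ys have "length xs = n" by auto
    with xs CA have "f (bracket A xs) = bracket B ys" "bracket A xs \<in> C"
      using h(5)[of xs] cl(4)[of xs] by auto
    then show ?thesis by (metis image_eqI)
  qed
  moreover have "f u \<oplus>\<^bsub>B\<^esub> f v \<in> f ` C" if "u \<in> C" "v \<in> C" for u v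
    using h(3)[of u v] cl(2)[OF that] that CA by (metis image_eqI subsetD)
  moreover have "c \<odot>\<^bsub>B\<^esub> f u \<in> f ` C" if "c \<in> carrier K" "u \<in> C" for c u
    using h(4)[of c u] cl(3)[OF that] that CA by (metis image_eqI subsetD)
  moreover have "\<zero>\<^bsub>B\<^esub> \<in> f ` C" "f ` C \<subseteq> carrier B"
    using h(1,2) cl(1) CA by (metis image_eqI, blast)
  ultimately show ?thesis
    unfolding nlie_subalgebra_iff[OF algB] closed_operations_def by simp
qed

lemma nlie_hom_vimage_subalgebra:
  assumes algA: "nlie_algebra K A n" and algB: "nlie_algebra K B n"
    and hom: "nlie_hom K A B n f" and D: "nlie_subalgebra K B n D"
  shows "nlie_subalgebra K A n {x \<in> carrier A. f x \<in> D}"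
proof -
  interpret nlie_algebra K A n by fact
  have "closed_operations K (B\<lparr>carrier := D\<rparr>) n"
    using D nlie_subalgebra_iff[OF algB] by auto
  note cl = closed_operationsD[OF this, simplified] and h = nlie_homD[OF hom]
  have "bracket A xs \<in> carrier A \<and> f (bracket A xs) \<in> D"
    if xs: "length xs = n" "set xs \<subseteq> {x \<in> carrier A. f x \<in> D}" for xs
  proof -
    have "set xs \<subseteq> carrier A" "set (map f xs) \<subseteq> D" using xs by auto
    then show ?thesis
      using xs(1) h(5)[of xs] cl(4)[of "map f xs"] bracket_closed[of xs] by simp
  qed
  then show ?thesis
    unfolding nlie_subalgebra_iff[OF algA] closed_operations_def by (auto simp: h cl)
qed

lemma nlie_hom_image_ideal:
  assumes algA: "nlie_algebra K A n" and algB: "nlie_algebra K B n"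
    and hom: "nlie_hom K A B n f" and onto: "f ` carrier A = carrier B"
    and I: "nlie_ideal K A n I"
  shows "nlie_ideal K B n (f ` I)"
proof -
  interpret nlie_algebra K A n by fact
  have IA: "I \<subseteq> carrier A" and cl: "\<zero>\<^bsub>A\<^esub> \<in> I" "\<And>x y. x \<in> I \<Longrightarrow> y \<in> I \<Longrightarrow> x \<oplus>\<^bsub>A\<^esub> y \<in> I"
    "\<And>c x. c \<in> carrier K \<Longrightarrow> x \<in> I \<Longrightarrow> c \<odot>\<^bsub>A\<^esub> x \<in> I"
    "\<And>x ys. x \<in> I \<Longrightarrow> length ys = n - 1 \<Longrightarrow> set ys \<subseteq> carrier A \<Longrightarrow> bracket A (x # ys) \<in> I"
    using I nlie_ideal_iff[OF algA] by auto
  note h = nlie_homD[OF hom]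
  have "bracket B (f u # ys) \<in> f ` I"
    if u: "u \<in> I" and ys: "length ys = n - 1" "set ys \<subseteq> carrier B" for u ys
  proof -
    obtain zs where zs: "set zs \<subseteq> carrier A" "map f zs = ys"
      using map_lift_list[of ys f "carrier A"] ys onto by auto
    have l: "length zs = n - 1" using zs ys by auto
    have "f (bracket A (u # zs)) = bracket B (map f (u # zs))"
      using zs u IA n_ge_2 l by (intro h(5)) auto
    moreover have "bracket A (u # zs) \<in> I"
      using cl(4) u zs l by auto
    ultimately show ?thesis using zs(2) by (metis image_eqI list.map(2))
  qed
  moreover have "f u \<oplus>\<^bsub>B\<^esub> f v \<in> f ` I" if "u \<in> I" "v \<in> I" for u v
    using h(3)[of u v] cl(2)[OF that] that IA by (metis image_eqI subsetD)
  moreover have "c \<odot>\<^bsub>B\<^esub> f u \<in> f ` I" if "c \<in> carrier K" "u \<in> I" for c u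
    using h(4)[of c u] cl(3)[OF that] that IA by (metis image_eqI subsetD)
  moreover have "\<zero>\<^bsub>B\<^esub> \<in> f ` I" "f ` I \<subseteq> carrier B"
    using h(1,2) cl(1) IA by (metis image_eqI, blast)
  ultimately show ?thesis
    unfolding nlie_ideal_iff[OF algB] by simp
qed

lemma nlie_hom_restrict:
  assumes hom: "nlie_hom K A B n f" and C: "C \<subseteq> carrier A"
  shows "nlie_hom K (A\<lparr>carrier := C\<rparr>) (B\<lparr>carrier := f ` C\<rparr>) n f"
proof -
  note h = nlie_homD[OF hom]
  have C': "x \<in> carrier A" if "x \<in> C" for x using that C by blast
  have "f (bracket A xs) = bracket B (map f xs)" if "length xs = n" "set xs \<subseteq> C" for xs
    using that C by (intro h(5)) auto
  then show ?thesis
    unfolding nlie_hom_def by (simp add: h C')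
qed

text \<open>
  A subalgebra \<open>N\<close> strictly above the preimage of \<open>M\<close> has an image strictly above \<open>M\<close>, so the
  image is all of \<open>B\<close>.  As \<open>N\<close> contains the kernel of \<open>f\<close>, it is all of \<open>A\<close>.
\<close>

lemma nlie_hom_vimage_maximal:
  assumes algA: "nlie_algebra K A n" and algB: "nlie_algebra K B n"
    and hom: "nlie_hom K A B n f" and onto: "f ` carrier A = carrier B"
    and M: "maximal_subalgebra K B n M"
  shows "maximal_subalgebra K A n {x \<in> carrier A. f x \<in> M}" (is "maximal_subalgebra K A n ?P")
  unfolding maximal_subalgebra_def
proof (intro conjI allI impI)
  interpret A: nlie_algebra K A n by fact
  interpret B: nlie_algebra K B n by fact
  have sM: "nlie_subalgebra K B n M" "M \<noteq> carrier B" and MB: "M \<subseteq> carrier B"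
    using M nlie_subalgebra_iff[OF algB] unfolding maximal_subalgebra_def by blast+
  show "nlie_subalgebra K A n ?P"
    by (rule nlie_hom_vimage_subalgebra[OF algA algB hom sM(1)])
  obtain y where "y \<in> carrier B" "y \<notin> M" using sM(2) MB by auto
  then obtain x where "x \<in> carrier A" "f x \<notin> M" using onto by (metis imageE)
  then show "?P \<noteq> carrier A" by (metis (no_types, lifting) mem_Collect_eq)
  note h = nlie_homD[OF hom]
  fix N assume N: "nlie_subalgebra K A n N \<and> ?P \<subset> N"
  then have NA: "N \<subseteq> carrier A" and clN: "closed_operations K (A\<lparr>carrier := N\<rparr>) n"
    using nlie_subalgebra_iff[OF algA] by auto
  have "M \<subset> f ` N"
  proof
    show "M \<subseteq> f ` N"
    proof
      fix y assume y: "y \<in> M"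
      then have "y \<in> f ` carrier A" using onto MB by (metis subsetD)
      then obtain x where "x \<in> carrier A" "f x = y" by (metis imageE)
      then have "x \<in> ?P" using y by simp
      then have "x \<in> N" using psubset_imp_subset[OF conjunct2[OF N]] by (rule rev_subsetD)
      then show "y \<in> f ` N" using \<open>f x = y\<close> by (metis imageI)
    qed
    obtain x where "x \<in> N - ?P" using psubset_imp_ex_mem[OF conjunct2[OF N]] ..
    then have "x \<in> N" "f x \<notin> M" using subsetD[OF NA] by simp_all
    then show "M \<noteq> f ` N" by (metis imageI)
  qed
  moreover have "nlie_subalgebra K B n (f ` N)"
    using nlie_hom_image_subalgebra[OF algA algB hom] N by auto
  ultimately have fN: "f ` N = carrier B"
    using M unfolding maximal_subalgebra_def by (metis (no_types))
  have "x \<in> N" if x: "x \<in> carrier A" for x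
  proof -
    have "f x \<in> f ` N" using h(1)[OF x] fN by simp
    then obtain u where u: "u \<in> N" "f u = f x" by (metis imageE)
    have uA: "u \<in> carrier A" using u NA by auto
    \<comment> \<open>\<open>x - u\<close> lies in the kernel of \<open>f\<close>, hence in the preimage of \<open>M\<close>, hence in \<open>N\<close>.\<close>
    have m: "(\<ominus>\<^bsub>K\<^esub> \<one>\<^bsub>K\<^esub>) \<odot>\<^bsub>A\<^esub> u = \<ominus>\<^bsub>A\<^esub> u"
      using uA by (simp add: A.smult_l_minus)
    have "f ((\<ominus>\<^bsub>K\<^esub> \<one>\<^bsub>K\<^esub>) \<odot>\<^bsub>A\<^esub> u) = (\<ominus>\<^bsub>K\<^esub> \<one>\<^bsub>K\<^esub>) \<odot>\<^bsub>B\<^esub> f u"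
      using uA by (intro h(4)) simp_all
    also have "\<dots> = \<ominus>\<^bsub>B\<^esub> f x" using u(2) h(1)[OF x] by (simp add: B.smult_l_minus)
    finally have "f (\<ominus>\<^bsub>A\<^esub> u) = \<ominus>\<^bsub>B\<^esub> f x" by (simp only: m)
    then have "f (x \<oplus>\<^bsub>A\<^esub> \<ominus>\<^bsub>A\<^esub> u) = f x \<oplus>\<^bsub>B\<^esub> \<ominus>\<^bsub>B\<^esub> f x"
      using h(3)[OF x, of "\<ominus>\<^bsub>A\<^esub> u"] uA by simp
    also have "\<dots> = \<zero>\<^bsub>B\<^esub>" using h(1)[OF x] by (rule B.r_neg)
    also have "\<zero>\<^bsub>B\<^esub> \<in> M"
      using sM unfolding nlie_subalgebra_iff[OF algB] closed_operations_def by auto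
    finally have "x \<oplus>\<^bsub>A\<^esub> \<ominus>\<^bsub>A\<^esub> u \<in> ?P" using uA x by simp
    then have "x \<oplus>\<^bsub>A\<^esub> \<ominus>\<^bsub>A\<^esub> u \<in> N"
      using psubset_imp_subset[OF conjunct2[OF N]] by (rule rev_subsetD)
    then have "(x \<oplus>\<^bsub>A\<^esub> \<ominus>\<^bsub>A\<^esub> u) \<oplus>\<^bsub>A\<^esub> u \<in> N"
      using closed_operationsD(2)[OF clN] u(1) by simp
    then show ?thesis using x uA by (simp add: A.a_assoc A.l_neg)
  qed
  then show "N = carrier A" using NA by auto
qed

text \<open>
  Surjectivity enters twice: it makes preimages of maximal subalgebras maximal, and it makes
  images of ideals ideals.
\<close>

lemma nlie_hom_frattini_ideal:
  assumes algA: "nlie_algebra K A n" and algB: "nlie_algebra K B n"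
    and hom: "nlie_hom K A B n f" and onto: "f ` carrier A = carrier B"
  shows "f ` frattini_ideal K A n \<subseteq> frattini_ideal K B n"
proof (rule nlie_algebra.frattini_ideal_largest(3)[OF algB])
  note \<Phi> = nlie_algebra.frattini_ideal_largest[OF algA]
  show "nlie_ideal K B n (f ` frattini_ideal K A n)"
    by (rule nlie_hom_image_ideal[OF algA algB hom onto \<Phi>(1)])
  have "f x \<in> frattini K B n" if x: "x \<in> frattini K A n" for x
  proof -
    have "f x \<in> M" if "maximal_subalgebra K B n M" for M
      using x nlie_hom_vimage_maximal[OF algA algB hom onto that] unfolding frattini_def by blast
    moreover have "f x \<in> carrier B"
      using x nlie_homD(1)[OF hom] unfolding frattini_def by simp
    ultimately show ?thesis
      unfolding frattini_def by simp
  qed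
  then show "f ` frattini_ideal K A n \<subseteq> frattini K B n"
    using \<Phi>(2) by blast
qed

text \<open>
  For a subalgebra \<open>C\<close> of \<open>B\<close>, each \<open>f i\<close> restricts to a surjection from \<open>C\<close> onto a subalgebra
  of the elementary algebra \<open>S i\<close>, so it sends the Frattini ideal of \<open>C\<close> to zero.
\<close>

theorem elementary_if_separated:
  fixes B :: "('k, 'v, 'y) nlie_scheme" and S :: "'i \<Rightarrow> ('k, 'w, 'z) nlie_scheme"
  assumes K: "field K" and n: "2 \<le> n"
    and closed: "closed_operations K B n"
    and hom: "\<And>i. i \<in> J \<Longrightarrow> nlie_hom K B (S i) n (f i)"
    and elem: "\<And>i. i \<in> J \<Longrightarrow> elementary_nlie_algebra K (S i) n"
    and sep: "\<And>x y. \<lbrakk>x \<in> carrier B; y \<in> carrier B; \<And>i. i \<in> J \<Longrightarrow> f i x = f i y\<rbrakk> \<Longrightarrow> x = y"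
  shows "elementary_nlie_algebra K B n"
  unfolding elementary_nlie_algebra_def
proof (intro conjI allI impI)
  have alg: "nlie_algebra K (S i) n" if "i \<in> J" for i
    using elem[OF that] unfolding elementary_nlie_algebra_def by blast
  show algB: "nlie_algebra K B n"
    by (rule nlie_algebra_if_separated[OF K n closed hom alg sep])
  interpret B: nlie_algebra K B n by (rule algB)
  fix C assume C: "nlie_subalgebra K B n C"
  let ?\<Phi> = "frattini_ideal K (B\<lparr>carrier := C\<rparr>) n"
  have CB: "C \<subseteq> carrier B" using C nlie_subalgebra_iff[OF algB] by blast
  note algC = nlie_algebra_subalgebra[OF algB C]
  note \<Phi> = nlie_algebra.frattini_ideal_largest(1)[OF algC]
  have \<Phi>C: "?\<Phi> \<subseteq> C" "\<zero>\<^bsub>B\<^esub> \<in> ?\<Phi>"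
    using \<Phi>[unfolded nlie_ideal_iff[OF algC]] by simp_all
  have "x = \<zero>\<^bsub>B\<^esub>" if x: "x \<in> ?\<Phi>" for x
  proof (rule sep)
    fix i assume i: "i \<in> J"
    let ?D = "f i ` C"
    have D: "nlie_subalgebra K (S i) n ?D"
      by (rule nlie_hom_image_subalgebra[OF algB alg[OF i] hom[OF i] C])
    have "nlie_hom K (B\<lparr>carrier := C\<rparr>) (S i\<lparr>carrier := ?D\<rparr>) n (f i)"
      by (rule nlie_hom_restrict[OF hom[OF i] CB])
    from nlie_hom_frattini_ideal[OF algC nlie_algebra_subalgebra[OF alg[OF i] D] this]
    have "f i x \<in> frattini_ideal K (S i\<lparr>carrier := ?D\<rparr>) n"
      using x by (simp add: image_subset_iff)
    moreover have "frattini_ideal K (S i\<lparr>carrier := ?D\<rparr>) n = {\<zero>\<^bsub>S i\<^esub>}"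
      using elem[OF i] D unfolding elementary_nlie_algebra_def by blast
    ultimately show "f i x = f i \<zero>\<^bsub>B\<^esub>" by (simp add: nlie_homD(2)[OF hom[OF i]])
  next
    show "x \<in> carrier B" using x \<Phi>C(1) CB by (meson subsetD)
  qed (rule B.zero_closed)
  then show "?\<Phi> = {\<zero>\<^bsub>B\<^esub>}" using \<Phi>C(2) by blast
qed

section \<open>A minimal supplement of an ideal\<close>

text \<open>
  The size of a largest linearly independent subset is bounded by the dimension of \<open>V\<close> and
  drops strictly from a subspace to a proper subspace: an independent subset of the smaller one
  stays independent when a vector outside the smaller one is added.
\<close>

lemma (in vectorspace) ex_minimal_subspace:
  assumes fd: "fin_dim" and "P U" and sub: "\<And>W. P W \<Longrightarrow> subspace K W V"
  shows "\<exists>W. P W \<and> (\<forall>W'. P W' \<and> W' \<subseteq> W \<longrightarrow> W' = W)"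
proof -
  define r where "r W = Max (card ` {B. B \<subseteq> W \<and> lin_indpt B})" for W
  have car: "W \<subseteq> carrier V" if "P W" for W
    using submodule.subset sub[OF that] unfolding subspace_def by blast
  have fin: "finite (card ` {B. B \<subseteq> W \<and> lin_indpt B})" if "P W" for W
    by (rule finite_subset[of _ "{..dim}"]) (use li_le_dim(2)[OF fd] car[OF that] in auto)
  have ne: "card ` {B. B \<subseteq> W \<and> lin_indpt B} \<noteq> {}" for W
  proof -
    have "lin_indpt {}" unfolding lin_dep_def by auto
    then show ?thesis by blast
  qed
  obtain W where W: "P W" "\<And>W'. P W' \<Longrightarrow> r W \<le> r W'"
    using ex_has_least_nat[of P U r] \<open>P U\<close> by blast
  have "W' = W" if W': "P W'" "W' \<subseteq> W" for W'
  proof (rule ccontr)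
    assume "W' \<noteq> W"
    then obtain x where x: "x \<in> W" "x \<notin> W'" using W' by blast
    obtain B where B: "B \<subseteq> W'" "lin_indpt B" "r W' = card B"
      using Max_in[OF fin[OF W'(1)] ne] unfolding r_def by blast
    have BV: "B \<subseteq> carrier V" using B car[OF W'(1)] by blast
    have "span B \<subseteq> W'"
      using span_is_subset[OF B(1)] sub[OF W'(1)] unfolding subspace_def by blast
    then have "lin_indpt (B \<union> {x})"
      using lin_dep_iff_in_span[OF BV B(2), of x] x car[OF W(1)] B(1) by blast
    then have "card (B \<union> {x}) \<le> r W"
      unfolding r_def using B x W' by (intro Max_ge[OF fin[OF W(1)]]) blast
    moreover have "card (B \<union> {x}) = Suc (card B)"
      using li_le_dim(1)[OF fd BV B(2)] subsetD[OF B(1), of x] x(2)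
      by (auto simp: card_insert_if)
    ultimately show False using W(2)[OF W'(1)] B(3) by simp
  qed
  with W(1) show ?thesis by blast
qed

lemma (in vectorspace) subspace_abelian_subgroup:
  assumes "subspace K U V"
  shows "abelian_subgroup U V"
proof -
  interpret U: submodule K U V using assms by (simp add: subspace_def)
  have "\<ominus>\<^bsub>V\<^esub> x \<in> U" if "x \<in> U" for x
    using U.smult_closed[of "\<ominus>\<^bsub>K\<^esub> \<one>\<^bsub>K\<^esub>" x] that subsetD[OF U.subset that]
    by (simp add: smult_l_minus)
  then have "subgroup U (add_monoid V)"
    using U.subset U.zero_closed U.m_closed
    by (intro M.add.subgroupI) (auto simp: a_inv_def simp del: U.zero_closed)
  then show ?thesis
    by (intro abelian_subgroupI3 additive_subgroupI M.abelian_group_axioms)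
qed

text \<open>
  An ideal is defined to absorb in the first argument only; skew-symmetry under the transposition
  of the first and the \<open>i\<close>-th argument moves this to any position.
\<close>

lemma (in nlie_algebra) bracket_update_ideal:
  assumes I: "nlie_ideal K A n I" and xs: "length xs = n" "set xs \<subseteq> carrier A"
    and i: "i < n" and u: "u \<in> I"
  shows "bracket A (xs[i := u]) \<in> I"
proof -
  interpret I: abelian_subgroup I A 
    using I by (intro subspace_abelian_subgroup) (simp add: nlie_ideal_def)
  define ys where "ys = xs[i := u]"
  define zs where "zs = permute_list (transpose 0 i) ys"
  have ys: "length ys = n" "set ys \<subseteq> carrier A"
    using xs I.a_subset u set_update_subset_insert[of xs i u] unfolding ys_def by auto
  have p: "transpose 0 i permutes {..<n}"
    using i by (intro permutes_swap_id) auto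
  have lz: "length zs = n" and sz: "set zs = set ys"
    using p ys(1) unfolding zs_def by auto
  have "zs ! 0 = u"
    using p ys(1) i xs(1) unfolding zs_def by (subst permute_list_nth) (auto simp: ys_def)
  with lz i obtain ws where zs: "zs = u # ws" by (cases zs) auto
  have b: "bracket A zs \<in> I"
    using I u lz sz ys(2) unfolding nlie_ideal_def zs by fastforce
  have bA: "bracket A zs \<in> carrier A" using b I.a_subset by blast
  have "bracket A ys = [sign (transpose 0 i)] \<cdot>\<^bsub>A\<^esub> bracket A zs"
    unfolding zs_def by (rule bracket_permute[OF ys p])
  moreover have "[sign (transpose 0 i)] \<cdot>\<^bsub>A\<^esub> bracket A zs \<in> I"
  proof (cases "transpose 0 i" rule: sign_cases)
    case even
    then show ?thesis using b M.add.int_pow_1[OF bA] by simp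
  next
    case odd
    then show ?thesis
      using b M.add.int_pow_neg[OF bA, of 1] M.add.int_pow_1[OF bA] by simp
  qed
  ultimately show ?thesis unfolding ys_def by simp
qed

text \<open>
  The bracket is well defined modulo an ideal.  The entries of \<open>ys\<close> are replaced by those of
  \<open>xs\<close> from left to right; each replacement changes the bracket by a bracket with one argument
  in \<open>I\<close>.
\<close>

lemma (in nlie_algebra) bracket_coset:
  assumes I: "nlie_ideal K A n I"
    and xs: "length xs = n" "set xs \<subseteq> carrier A" and ys: "length ys = n" "set ys \<subseteq> carrier A"
    and coset: "\<And>i. i < n \<Longrightarrow> xs ! i \<in> I +>\<^bsub>A\<^esub> ys ! i"
  shows "bracket A xs \<in> I +>\<^bsub>A\<^esub> bracket A ys"
proof -
  interpret I: abelian_subgroup I A 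
    using I by (intro subspace_abelian_subgroup) (simp add: nlie_ideal_def)
  have step: "bracket A (take k xs @ drop k ys) \<in> I +>\<^bsub>A\<^esub> bracket A ys" if "k \<le> n" for k
    using that
  proof (induction k)
    case 0
    show ?case using I.a_rcos_self[OF bracket_closed[OF ys]] by simp
  next
    case (Suc k)
    define zs where "zs = take k xs @ drop k ys"
    have k: "k < n" using Suc by simp
    have zs: "length zs = n" "set zs \<subseteq> carrier A" "zs ! k = ys ! k"
      using xs ys k set_take_subset[of k xs] set_drop_subset[of k ys]
      unfolding zs_def by (auto simp: nth_append)
    have upd: "take (Suc k) xs @ drop (Suc k) ys = zs[k := xs ! k]"
      using k xs(1) ys(1) unfolding zs_def
      by (simp add: take_Suc_conv_app_nth list_update_append Cons_nth_drop_Suc[symmetric])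
    obtain u where u: "u \<in> I" "xs ! k = u \<oplus>\<^bsub>A\<^esub> ys ! k"
      using coset[OF k] unfolding a_r_coset_def' by auto
    have yk: "ys ! k \<in> carrier A" using ys k nth_mem[of k ys] by auto
    have "bracket A (zs[k := xs ! k]) = bracket A (zs[k := u]) \<oplus>\<^bsub>A\<^esub> bracket A zs"
      using bracket_add[OF zs(1,2) k _ yk, of u] u I.a_subset zs(3)
      by (metis list_update_id subsetD)
    moreover have b: "bracket A (zs[k := u]) \<in> I"
      by (rule bracket_update_ideal[OF I zs(1,2) k u(1)])
    moreover obtain v where v: "v \<in> I" "bracket A zs = v \<oplus>\<^bsub>A\<^esub> bracket A ys"
      using Suc.IH k unfolding zs_def a_r_coset_def' by auto
    ultimately have "bracket A (zs[k := xs ! k]) =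
        (bracket A (zs[k := u]) \<oplus>\<^bsub>A\<^esub> v) \<oplus>\<^bsub>A\<^esub> bracket A ys"
      using bracket_closed[OF ys] by (simp add: a_assoc)
    then show ?case
      unfolding upd a_r_coset_def' using I.a_closed[OF b v(1)] by blast
  qed
  from step[of n] xs(1) ys(1) show ?thesis by simp
qed

lemma (in nlie_algebra) nlie_subalgebra_Int:
  assumes "nlie_subalgebra K A n C" "nlie_subalgebra K A n D"
  shows "nlie_subalgebra K A n (C \<inter> D)"
  using assms unfolding nlie_subalgebra_iff[OF nlie_algebra_axioms] closed_operations_def by simp blast

text \<open>
  A bracket of elements of \<open>I + M\<close> is congruent modulo \<open>I\<close> to the bracket of their components
  in \<open>M\<close>.
\<close>

lemma (in nlie_algebra) nlie_subalgebra_ideal_sum: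
  assumes I: "nlie_ideal K A n I" and M: "nlie_subalgebra K A n M"
  shows "nlie_subalgebra K A n (submodule_sum I M)"
  unfolding nlie_subalgebra_def
proof (intro conjI allI impI)
  have sm: "submodule K I A" "submodule K M A"
    using I M unfolding nlie_ideal_def nlie_subalgebra_def subspace_def by blast+
  show "subspace K (submodule_sum I M) A"
    by (rule subspace.intro[OF vectorspace_axioms sum_is_submodule[OF sm]])
  fix xs assume xs: "length xs = n \<and> set xs \<subseteq> submodule_sum I M"
  have "\<forall>x\<in>submodule_sum I M. \<exists>m\<in>M. x \<in> I +>\<^bsub>A\<^esub> m"
    unfolding submodule_sum_def a_r_coset_def' by auto
  then obtain g where g: "\<And>x. x \<in> submodule_sum I M \<Longrightarrow> g x \<in> M \<and> x \<in> I +>\<^bsub>A\<^esub> g x"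
    by metis
  have ms: "set (map g xs) \<subseteq> M" "length (map g xs) = n" using g xs by auto
  have carr: "set xs \<subseteq> carrier A" "set (map g xs) \<subseteq> carrier A"
    using xs ms(1) submodule.subset[OF sm(2)] submodule.subset[OF sum_is_submodule[OF sm]]
    by (metis subset_trans)+
  have "bracket A xs \<in> I +>\<^bsub>A\<^esub> bracket A (map g xs)"
  proof (rule bracket_coset[OF I _ carr(1) ms(2) carr(2)])
    fix i assume "i < n"
    then have "xs ! i \<in> submodule_sum I M" using xs nth_mem[of i xs] by blast
    then show "xs ! i \<in> I +>\<^bsub>A\<^esub> map g xs ! i"
      using g xs \<open>i < n\<close> by simp
  qed (use xs in simp)
  moreover have "bracket A (map g xs) \<in> M" using M ms unfolding nlie_subalgebra_def by blast
  ultimately show "bracket A xs \<in> submodule_sum I M"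
    unfolding a_r_coset_def' submodule_sum_def by auto
qed

text \<open>
  \<open>C\<close> is chosen minimal among the subalgebras whose sum with \<open>I\<close> is \<open>A\<close>.  A maximal subalgebra
  of \<open>C\<close> not containing \<open>I \<inter> C\<close> would be a smaller one.
\<close>

lemma (in nlie_algebra) ex_frattini_supplement:
  assumes fd: "fin_dim" and I: "nlie_ideal K A n I"
  obtains C where "nlie_subalgebra K A n C"
    and "\<And>x. x \<in> carrier A \<Longrightarrow> \<exists>u\<in>I. \<exists>c\<in>C. x = u \<oplus>\<^bsub>A\<^esub> c"
    and "I \<inter> C \<subseteq> frattini_ideal K (A\<lparr>carrier := C\<rparr>) n"
proof -
  interpret I: abelian_subgroup I A
    using I by (intro subspace_abelian_subgroup) (simp add: nlie_ideal_def)
  note sub_iff = nlie_subalgebra_iff[OF nlie_algebra_axioms]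
  note I_iff = I[unfolded nlie_ideal_iff[OF nlie_algebra_axioms]]
  define P where "P C \<longleftrightarrow> nlie_subalgebra K A n C \<and>
    (\<forall>x\<in>carrier A. \<exists>u\<in>I. \<exists>c\<in>C. x = u \<oplus>\<^bsub>A\<^esub> c)" for C
  have "\<exists>u\<in>I. \<exists>c\<in>carrier A. x = u \<oplus>\<^bsub>A\<^esub> c" if "x \<in> carrier A" for x
    using l_zero[OF that] that I.zero_closed by metis
  then have "P (carrier A)"
    unfolding P_def sub_iff closed_operations_def by (simp add: bracket_closed)
  moreover have "subspace K C A" if "P C" for C
    using that unfolding P_def nlie_subalgebra_def by blast
  ultimately have "\<exists>C. P C \<and> (\<forall>M. P M \<and> M \<subseteq> C \<longrightarrow> M = C)"
    by (rule ex_minimal_subspace[OF fd])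
  then obtain C where C: "P C" and min: "\<And>M. \<lbrakk>P M; M \<subseteq> C\<rbrakk> \<Longrightarrow> M = C"
    by blast
  have sC: "nlie_subalgebra K A n C"
    and dec: "\<And>x. x \<in> carrier A \<Longrightarrow> \<exists>u\<in>I. \<exists>c\<in>C. x = u \<oplus>\<^bsub>A\<^esub> c"
    using C unfolding P_def by auto
  have CA: "C \<subseteq> carrier A" and clC: "closed_operations K (A\<lparr>carrier := C\<rparr>) n"
    using sC unfolding sub_iff by auto
  note cl = closed_operationsD[OF clC, simplified]
  note algC = nlie_algebra_subalgebra[OF nlie_algebra_axioms sC]
  have sm: "c \<odot>\<^bsub>A\<^esub> u \<in> I" if "c \<in> carrier K" "u \<in> I" for c u
    using I_iff that by blast
  have idC: "nlie_ideal K (A\<lparr>carrier := C\<rparr>) n (I \<inter> C)"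
    unfolding nlie_ideal_iff[OF algC]
  proof (simp add: cl sm, intro ballI allI impI)
    fix x ys assume a: "x \<in> I \<inter> C" "length ys = n - Suc 0 \<and> set ys \<subseteq> C"
    show "bracket A (x # ys) \<in> I \<and> bracket A (x # ys) \<in> C"
      using a I CA n_ge_2 cl(4)[of "x # ys"] unfolding nlie_ideal_def by auto
  qed
  have max: "I \<inter> C \<subseteq> M" if M: "maximal_subalgebra K (A\<lparr>carrier := C\<rparr>) n M" for M
  proof (rule ccontr)
    assume "\<not> I \<inter> C \<subseteq> M"
    then obtain z where z: "z \<in> I" "z \<in> C" "z \<notin> M" by auto
    have sM: "nlie_subalgebra K A n M" and MC: "M \<subseteq> C" "M \<noteq> C"
      and M_max: "\<And>N. \<lbrakk>nlie_subalgebra K A n N; N \<subseteq> C; M \<subset> N\<rbrakk> \<Longrightarrow> N = C"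
      using M unfolding maximal_subalgebra_def
        nlie_subalgebra_subalgebra_iff[OF nlie_algebra_axioms sC] by simp_all
    have MA: "M \<subseteq> carrier A" "\<zero>\<^bsub>A\<^esub> \<in> M"
      using MC(1) CA sM unfolding sub_iff closed_operations_def by simp_all
    have cc: "u \<in> carrier A" if "u \<in> I \<or> u \<in> M" for u
      using that MA I.a_subset by blast
    define N where "N = submodule_sum I M \<inter> C"
    have N_iff: "x \<in> N \<longleftrightarrow> x \<in> C \<and> (\<exists>u\<in>I. \<exists>m\<in>M. x = u \<oplus>\<^bsub>A\<^esub> m)" for x
      unfolding N_def submodule_sum_def by auto
    have sN: "nlie_subalgebra K A n N"
      unfolding N_def by (intro nlie_subalgebra_Int nlie_subalgebra_ideal_sum I sM sC)
    have "m \<in> N" if "m \<in> M" for m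
      using that MC(1) l_zero[of m] cc[of m] I.zero_closed unfolding N_iff
      by (metis subsetD)
    moreover have "z \<in> N"
      using z(1,2) r_zero[of z] cc[of z] MA(2) unfolding N_iff by metis
    ultimately have "M \<subset> N" using z(3) by blast
    moreover have "N \<subseteq> C" unfolding N_def by blast
    ultimately have NC: "N = C" using M_max[OF sN] by blast
    have "\<exists>u\<in>I. \<exists>m\<in>M. x = u \<oplus>\<^bsub>A\<^esub> m" if x: "x \<in> carrier A" for x
    proof -
      obtain u c where *: "u \<in> I" "c \<in> C" "x = u \<oplus>\<^bsub>A\<^esub> c" using dec[OF x] by auto
      obtain v m where **: "v \<in> I" "m \<in> M" "c = v \<oplus>\<^bsub>A\<^esub> m" using *(2) N_iff unfolding NC by blast
      have "x = (u \<oplus>\<^bsub>A\<^esub> v) \<oplus>\<^bsub>A\<^esub> m" using * ** cc by (simp add: a_assoc)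
      then show ?thesis using I.a_closed[OF *(1) **(1)] **(2) by blast
    qed
    then have "P M" unfolding P_def using sM by blast
    with min MC show False by blast
  qed
  have "I \<inter> C \<subseteq> frattini K (A\<lparr>carrier := C\<rparr>) n"
    unfolding frattini_def using max by (simp add: le_Inf_iff)
  then have "I \<inter> C \<subseteq> frattini_ideal K (A\<lparr>carrier := C\<rparr>) n"
    by (rule nlie_algebra.frattini_ideal_largest(3)[OF algC idC])
  with sC dec that show ?thesis by blast
qed

section \<open>Quotients\<close>

lemma in_listset_iff: "xs \<in> listset Xs \<longleftrightarrow> list_all2 (\<in>) xs Xs"
  by (induction Xs arbitrary: xs) (auto simp: set_Cons_def list_all2_Cons2)

text \<open>
  The quotient operations on cosets are given by sums and unions over all representatives.  They
  return the coset of the result for any choice of representatives, because the operations of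
  \<open>A\<close> are well defined modulo \<open>I\<close>.
\<close>

lemma (in nlie_algebra) nlie_hom_quotient:
  assumes I: "nlie_ideal K A n I"
  shows "nlie_hom K A (nlie_quotient A I) n (\<lambda>x. I +>\<^bsub>A\<^esub> x)"
proof -
  interpret I: abelian_subgroup I A
    using I by (intro subspace_abelian_subgroup) (simp add: nlie_ideal_def)
  have eq: "I +>\<^bsub>A\<^esub> y = I +>\<^bsub>A\<^esub> x" if "y \<in> I +>\<^bsub>A\<^esub> x" "x \<in> carrier A" for x y
    using a_repr_independence[OF that I.a_subgroup] by simp
  have sm: "(\<Union>x'\<in>I +>\<^bsub>A\<^esub> x. I +>\<^bsub>A\<^esub> (c \<odot>\<^bsub>A\<^esub> x')) = I +>\<^bsub>A\<^esub> (c \<odot>\<^bsub>A\<^esub> x)"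
    if c: "c \<in> carrier K" and x: "x \<in> carrier A" for c x
  proof -
    have "I +>\<^bsub>A\<^esub> (c \<odot>\<^bsub>A\<^esub> x') = I +>\<^bsub>A\<^esub> (c \<odot>\<^bsub>A\<^esub> x)" if x': "x' \<in> I +>\<^bsub>A\<^esub> x" for x'
    proof (rule eq)
      obtain u where u: "u \<in> I" "x' = u \<oplus>\<^bsub>A\<^esub> x" using x' unfolding a_r_coset_def' by auto
      have "c \<odot>\<^bsub>A\<^esub> u \<in> I" using I u(1) c unfolding nlie_ideal_iff[OF nlie_algebra_axioms] by blast
      moreover have "c \<odot>\<^bsub>A\<^esub> x' = c \<odot>\<^bsub>A\<^esub> u \<oplus>\<^bsub>A\<^esub> c \<odot>\<^bsub>A\<^esub> x"
        using u c x by (simp add: smult_r_distr)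
      ultimately show "c \<odot>\<^bsub>A\<^esub> x' \<in> I +>\<^bsub>A\<^esub> (c \<odot>\<^bsub>A\<^esub> x)" unfolding a_r_coset_def' by blast
    qed (use c x in simp)
    then show ?thesis using I.a_rcos_self[OF x] by blast
  qed
  have br: "(\<Union>ys\<in>listset (map (\<lambda>x. I +>\<^bsub>A\<^esub> x) xs). I +>\<^bsub>A\<^esub> bracket A ys) = I +>\<^bsub>A\<^esub> bracket A xs"
    if xs: "length xs = n" "set xs \<subseteq> carrier A" for xs
  proof -
    have xs_i: "xs ! i \<in> carrier A" if "i < n" for i
      using xs that nth_mem[of i xs] by auto
    have "I +>\<^bsub>A\<^esub> bracket A ys = I +>\<^bsub>A\<^esub> bracket A xs"
      if "ys \<in> listset (map (\<lambda>x. I +>\<^bsub>A\<^esub> x) xs)" for ys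
    proof (rule eq)
      have ys: "length ys = n" "\<And>i. i < n \<Longrightarrow> ys ! i \<in> I +>\<^bsub>A\<^esub> xs ! i"
        using that xs unfolding in_listset_iff list_all2_conv_all_nth by auto
      then have "set ys \<subseteq> carrier A"
        using I.a_elemrcos_carrier[OF xs_i] by (auto simp: in_set_conv_nth)
      then show "bracket A ys \<in> I +>\<^bsub>A\<^esub> bracket A xs"
        using ys xs by (intro bracket_coset[OF I]) auto
    qed (rule bracket_closed[OF xs])
    moreover have "xs \<in> listset (map (\<lambda>x. I +>\<^bsub>A\<^esub> x) xs)"
      unfolding in_listset_iff list_all2_conv_all_nth using xs(1) xs_i I.a_rcos_self by simp
    ultimately show ?thesis by blast
  qed
  show ?thesis
    unfolding nlie_hom_def nlie_quotient_def
    by (simp add: image_subset_iff a_rcosetsI[OF I.a_subset] I.a_rcos_const[OF I.zero_closed]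
        I.a_rcos_sum sm br)
qed

lemma closed_operations_image:
  assumes A: "closed_operations K A n" and hom: "nlie_hom K A B n f"
    and onto: "f ` carrier A = carrier B"
  shows "closed_operations K B n"
proof -
  note cl = closed_operationsD[OF A] and h = nlie_homD[OF hom]
  have "bracket B ys \<in> carrier B" if ys: "length ys = n" "set ys \<subseteq> carrier B" for ys
  proof -
    obtain xs where xs: "set xs \<subseteq> carrier A" "map f xs = ys"
      using map_lift_list[of ys f "carrier A"] ys(2) onto by metis
    then have "length xs = n" using ys(1) by auto
    then show ?thesis
      using h(1)[OF cl(4)[of xs]] h(5)[of xs] xs by simp
  qed
  moreover have "f x \<oplus>\<^bsub>B\<^esub> f y \<in> carrier B" if "x \<in> carrier A" "y \<in> carrier A" for x y
    using h(3)[OF that] h(1)[OF cl(2)[OF that]] by simp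
  then have "x \<oplus>\<^bsub>B\<^esub> y \<in> carrier B" if "x \<in> carrier B" "y \<in> carrier B" for x y
    using that unfolding onto[symmetric] by blast
  moreover have "c \<odot>\<^bsub>B\<^esub> f x \<in> carrier B" if "c \<in> carrier K" "x \<in> carrier A" for c x
    using h(4)[OF that] h(1)[OF cl(3)[OF that]] by simp
  then have "c \<odot>\<^bsub>B\<^esub> x \<in> carrier B" if "c \<in> carrier K" "x \<in> carrier B" for c x
    using that unfolding onto[symmetric] by blast
  moreover have "\<zero>\<^bsub>B\<^esub> \<in> carrier B" using h(2) h(1)[OF cl(1)] by simp
  ultimately show ?thesis unfolding closed_operations_def by simp
qed

text \<open>
  The supplement \<open>C\<close> of \<open>I\<close> meets \<open>I\<close> only in zero, because \<open>I \<inter> C\<close> lies in the Frattini ideal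
  of the subalgebra \<open>C\<close>.  So \<open>\<pi>\<close> maps \<open>C\<close> bijectively onto the quotient, and the inverse \<open>\<psi>\<close>
  of this bijection is an injective homomorphism into \<open>A\<close>.
\<close>

theorem elementary_quotient:
  assumes A: "elementary_nlie_algebra K A n" and fd: "vectorspace.fin_dim K A"
    and I: "nlie_ideal K A n I"
  shows "elementary_nlie_algebra K (nlie_quotient A I) n"
proof -
  have alg: "nlie_algebra K A n" using A unfolding elementary_nlie_algebra_def by blast
  interpret nlie_algebra K A n by (rule alg)
  interpret I: abelian_subgroup I A
    using I by (intro subspace_abelian_subgroup) (simp add: nlie_ideal_def)
  define Q where "Q = nlie_quotient A I"
  define \<pi> where "\<pi> x = I +>\<^bsub>A\<^esub> x" for x
  obtain C where C: "nlie_subalgebra K A n C"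
    and dec: "\<And>x. x \<in> carrier A \<Longrightarrow> \<exists>u\<in>I. \<exists>c\<in>C. x = u \<oplus>\<^bsub>A\<^esub> c"
    and \<Phi>: "I \<inter> C \<subseteq> frattini_ideal K (A\<lparr>carrier := C\<rparr>) n"
    using ex_frattini_supplement[OF fd I] by metis
  interpret C: abelian_subgroup C A
    using C by (intro subspace_abelian_subgroup) (simp add: nlie_subalgebra_def)
  have IC: "I \<inter> C \<subseteq> {\<zero>\<^bsub>A\<^esub>}"
    using A C \<Phi> unfolding elementary_nlie_algebra_def by blast
  have CA: "c \<in> carrier A" if "c \<in> C" for c using that C.a_subset by blast
  have "closed_operations K (A\<lparr>carrier := C\<rparr>) n"
    using C unfolding nlie_subalgebra_iff[OF alg] by blast
  note cl = closed_operationsD[OF this, simplified]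
  have hom: "nlie_hom K A Q n \<pi>"
    unfolding Q_def \<pi>_def by (rule nlie_hom_quotient[OF I])
  note h = nlie_homD[OF hom]
  have onto: "\<pi> ` carrier A = carrier Q"
    unfolding \<pi>_def Q_def nlie_quotient_def A_RCOSETS_def' by auto
  have clA: "closed_operations K A n"
    unfolding closed_operations_def by (simp add: bracket_closed)
  have clQ: "closed_operations K Q n" by (rule closed_operations_image[OF clA hom onto])
  have \<pi>C: "\<pi> ` C = carrier Q"
  proof
    show "\<pi> ` C \<subseteq> carrier Q" using h(1) CA by blast
    show "carrier Q \<subseteq> \<pi> ` C"
    proof
      fix X assume "X \<in> carrier Q"
      then obtain x where x: "x \<in> carrier A" "X = \<pi> x" using onto by (metis imageE)
      obtain u c where uc: "u \<in> I" "c \<in> C" "x = u \<oplus>\<^bsub>A\<^esub> c" using dec[OF x(1)] by blast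
      then have "x \<in> I +>\<^bsub>A\<^esub> c" unfolding a_r_coset_def' by blast
      from a_repr_independence[OF this CA[OF uc(2)] I.a_subgroup]
      show "X \<in> \<pi> ` C" using uc(2) x(2) unfolding \<pi>_def by blast
    qed
  qed
  have inj: "c = d" if cd: "c \<in> C" "d \<in> C" "\<pi> c = \<pi> d" for c d
  proof -
    have "c \<in> I +>\<^bsub>A\<^esub> d" using I.a_rcos_self[OF CA[OF cd(1)]] cd(3) unfolding \<pi>_def by simp
    then have "c \<oplus>\<^bsub>A\<^esub> \<ominus>\<^bsub>A\<^esub> d \<in> I" by (rule I.a_rcos_module_imp[OF CA[OF cd(2)]])
    moreover have "c \<oplus>\<^bsub>A\<^esub> \<ominus>\<^bsub>A\<^esub> d \<in> C" using cd by simp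
    ultimately have "c \<oplus>\<^bsub>A\<^esub> \<ominus>\<^bsub>A\<^esub> d = \<zero>\<^bsub>A\<^esub>" using IC by blast
    then show ?thesis using CA cd(1,2) minus_equality[of c "\<ominus>\<^bsub>A\<^esub> d"] by simp
  qed
  define \<psi> where "\<psi> = the_inv_into C \<pi>"
  have \<psi>: "\<psi> (\<pi> c) = c" if "c \<in> C" for c
    unfolding \<psi>_def using that inj by (intro the_inv_into_f_f) (auto simp: inj_on_def)
  have "\<psi> (bracket Q Xs) = bracket A (map \<psi> Xs)"
    if Xs: "length Xs = n" "set Xs \<subseteq> carrier Q" for Xs
  proof -
    obtain cs where cs: "set cs \<subseteq> C" "map \<pi> cs = Xs"
      using map_lift_list[of Xs \<pi> C] Xs(2) \<pi>C by metis
    then have l: "length cs = n" using Xs(1) by auto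
    have "bracket Q Xs = \<pi> (bracket A cs)"
      using h(5)[OF l] cs C.a_subset by simp
    moreover have "map \<psi> Xs = cs"
      using cs(1) \<psi> unfolding cs(2)[symmetric] by (auto intro!: map_idI)
    ultimately show ?thesis using \<psi>[OF cl(4)[OF l cs(1)]] by simp
  qed
  moreover have "\<psi> (X \<oplus>\<^bsub>Q\<^esub> Y) = \<psi> X \<oplus>\<^bsub>A\<^esub> \<psi> Y" if "X \<in> carrier Q" "Y \<in> carrier Q" for X Y
  proof -
    obtain c d where "c \<in> C" "d \<in> C" "X = \<pi> c" "Y = \<pi> d"
      using \<pi>C \<open>X \<in> carrier Q\<close> \<open>Y \<in> carrier Q\<close> by (metis imageE)
    then show ?thesis using h(3)[of c d, symmetric] CA \<psi> cl(2)[of c d] by simp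
  qed
  moreover have "\<psi> (k \<odot>\<^bsub>Q\<^esub> X) = k \<odot>\<^bsub>A\<^esub> \<psi> X" if "k \<in> carrier K" "X \<in> carrier Q" for k X
  proof -
    obtain c where "c \<in> C" "X = \<pi> c" using \<pi>C \<open>X \<in> carrier Q\<close> by (metis imageE)
    then show ?thesis using h(4)[of k c, symmetric] CA \<psi> cl(3)[of k c] that by simp
  qed
  moreover have "\<psi> \<zero>\<^bsub>Q\<^esub> = \<zero>\<^bsub>A\<^esub>" using \<psi>[OF C.zero_closed] h(2) by simp
  moreover have "\<psi> X \<in> C" if "X \<in> carrier Q" for X
    using that \<psi> \<pi>C by (metis imageE)
  ultimately have "nlie_hom K Q A n \<psi>"
    unfolding nlie_hom_def using CA by (simp add: image_subset_iff)
  moreover have "X = Y" if "X \<in> carrier Q" "Y \<in> carrier Q" "\<psi> X = \<psi> Y" for X Y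
    using that \<psi> \<pi>C by (metis imageE)
  ultimately have "elementary_nlie_algebra K Q n"
    using elementary_if_separated[OF field_axioms n_ge_2 clQ,
        where J = "{()}" and S = "\<lambda>_. A" and f = "\<lambda>_. \<psi>"] A
    by blast
  then show ?thesis unfolding Q_def .
qed

section \<open>Direct sums and the main result\<close>

theorem elementary_direct_sum:
  fixes S :: "'i \<Rightarrow> ('k, 'v, 'z) nlie_scheme"
  assumes K: "field K" and n: "2 \<le> n"
    and elem: "\<And>i. i \<in> J \<Longrightarrow> elementary_nlie_algebra K (S i) n"
  shows "elementary_nlie_algebra K (nlie_direct_sum J S) n"
proof (rule elementary_if_separated[OF K n _ _ elem])
  have alg: "nlie_algebra K (S i) n" if "i \<in> J" for i
    using elem[OF that] unfolding elementary_nlie_algebra_def by blast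
  have cl: "closed_operations K (S i) n" if "i \<in> J" for i
  proof -
    interpret nlie_algebra K "S i" n by (rule alg[OF that])
    show ?thesis unfolding closed_operations_def by (simp add: bracket_closed)
  qed
  have "bracket (S i) (map (\<lambda>f. f i) fs) \<in> carrier (S i)"
    if "i \<in> J" "length fs = n" "set fs \<subseteq> (\<Pi>\<^sub>E i\<in>J. carrier (S i))" for fs i
    using that by (intro closed_operationsD(4)[OF cl]) auto
  then show "closed_operations K (nlie_direct_sum J S) n"
    unfolding closed_operations_def nlie_direct_sum_def
    using closed_operationsD(1-3)[OF cl] by (simp add: PiE_iff)
  show "nlie_hom K (nlie_direct_sum J S) (S i) n (\<lambda>f. f i)" if "i \<in> J" for i
    unfolding nlie_hom_def nlie_direct_sum_def using that by (auto simp: PiE_iff)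
  show "f = g" if "f \<in> carrier (nlie_direct_sum J S)" "g \<in> carrier (nlie_direct_sum J S)"
    "\<And>i. i \<in> J \<Longrightarrow> f i = g i" for f g
    using that unfolding nlie_direct_sum_def by (auto intro: PiE_ext)
qed

theorem theorem3p1:
  fixes K :: "('k, 'm) ring_scheme" and n :: nat
  assumes "field K" and "2 \<le> n"
  shows
    "(\<forall>A :: ('k, 'v) nlie.
        elementary_nlie_algebra K A n \<and> vectorspace.fin_dim K A \<longrightarrow>
          (\<forall>B. nlie_subalgebra K A n B \<longrightarrow> elementary_nlie_algebra K (A\<lparr>carrier := B\<rparr>) n) \<and>
          (\<forall>I. nlie_ideal K A n I \<longrightarrow> elementary_nlie_algebra K (nlie_quotient A I) n)) \<and>
     (\<forall>(J :: 'i set) (S :: 'i \<Rightarrow> ('k, 'w) nlie).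
        finite J \<and>
        (\<forall>i\<in>J. elementary_nlie_algebra K (S i) n \<and> vectorspace.fin_dim K (S i)) \<longrightarrow>
          elementary_nlie_algebra K (nlie_direct_sum J S) n)"
  by (intro conjI allI impI; elim conjE)
    (rule elementary_subalgebra elementary_quotient elementary_direct_sum[OF assms]; blast)+

end
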